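(* Let $H$ be a separable infinite-dimensional Hilbert space, and let $(f_n)_{n=1}^\infty$ and $(g_n)_{n=1}^\infty$ be frames in $H$. If $(f_n)_{n=1}^\infty$ and $(g_n)_{n=1}^\infty$ are pseudo-dual to each other, then $e((f_n)_{n=1}^\infty)=e((g_n)_{n=1}^\infty)$. In particular, if $(f_n)_{n=1}^\infty$ and $(g_n)_{n=1}^\infty$ are approximately dual to each other, then $e((f_n)_{n=1}^\infty)=e((g_n)_{n=1}^\infty)$.
   Context: A sequence $(f_n)_{n=1}^\infty$ in $H$ is a frame if there exist constants $A,B>0$ with $A\|x\|^2\le\sum_{n=1}^\infty|\langle x,f_n\rangle|^2\le B\|x\|^2$ for all $x\in H$. Its analysis operator is the bounded operator $U:H\to l^2$, $Ux=(\langle x,f_n\rangle)_{n=1}^\infty$. Let $U$ and $V$ be the analysis operators of frames $(f_n)_{n=1}^\infty$ and $(g_n)_{n=1}^\infty$ in $H$, respectively. The frames are pseudo-dual to each other if $V^*U$ is an invertible operator on $H$; they are approximately dual to each other if $\|V^*U-I\|<1$, where $I$ is the identity operator on $H$. The excess $e((f_n)_{n=1}^\infty)$ of a frame is the greatest integer $k$ such that some $k$ elements can be deleted from the frame and still leave a complete set (a set whose closed linear span is $H$), or $+\infty$ if there is no upper bound to the number of elements that can be removed. *)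

theory Defs
  imports "HOL-Analysis.Analysis" "HOL-Library.Extended_Nat"
begin

text \<open>
  Scalar fields: the real and the complex numbers, treated uniformly. The axiom \<open>mult_conj\<close>
  determines \<open>conj\<close>, so it is the identity on the reals and \<open>cnj\<close> on the complex numbers;
  the other axioms are included for convenience.
\<close>

class real_or_complex = real_normed_field +
  fixes conj :: "'a \<Rightarrow> 'a"
  assumes mult_conj: "x * conj x = ((norm x)\<^sup>2) *\<^sub>R 1"
    and conj_add: "conj (x + y) = conj x + conj y"
    and conj_mult: "conj (x * y) = conj x * conj y"
    and conj_conj: "conj (conj x) = x"

instantiation real :: real_or_complex
begin
definition conj_real :: "real \<Rightarrow> real" where "conj_real x = x"
instance
  by standard (simp_all add: conj_real_def power2_eq_square)
end

instantiation complex :: real_or_complex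
begin
definition conj_complex :: "complex \<Rightarrow> complex" where "conj_complex = cnj"
instance
  by standard (simp_all add: conj_complex_def complex_norm_square scaleR_conv_of_real del: of_real_power)
end

text \<open>
  Completeness of the space is part of the class \<open>banach\<close>; the axioms \<open>scale_of_real\<close> and
  \<open>inner_self\<close> say that the real vector space structure and the norm of the type are the ones
  induced by \<open>smul\<close> and \<open>ip\<close>. Hence \<open>closure\<close>, \<open>onorm\<close>, etc. have their usual meaning.
  The inner product is linear in its first argument.
\<close>

locale hilbert_space = vector_space smul
  for smul :: "'k::real_or_complex \<Rightarrow> 'h::banach \<Rightarrow> 'h" +
  fixes ip :: "'h \<Rightarrow> 'h \<Rightarrow> 'k"
  assumes scale_of_real: "smul (of_real r) x = r *\<^sub>R x"
    and inner_add_left: "ip (x + y) z = ip x z + ip y z"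
    and inner_scale_left: "ip (smul a x) y = a * ip x y"
    and inner_commute: "ip x y = conj (ip y x)"
    and inner_self: "ip x x = of_real ((norm x)\<^sup>2)"

lemma hilbert_space_real_inner:
  "hilbert_space scaleR (inner :: 'h::{real_inner, banach} \<Rightarrow> 'h \<Rightarrow> real)"
  by unfold_locales
    (simp_all add: algebra_simps inner_commute conj_real_def power2_norm_eq_inner)

lemma hilbert_space_complex: "hilbert_space (*) (\<lambda>x y::complex. x * cnj y)"
  by unfold_locales
    (simp_all add: algebra_simps conj_complex_def scaleR_conv_of_real complex_norm_square
      del: of_real_power)

definition infinite_dimensional :: "('k::field \<Rightarrow> 'h::ab_group_add \<Rightarrow> 'h) \<Rightarrow> bool" where
  "infinite_dimensional smul \<longleftrightarrow> \<not> (\<exists>B. finite B \<and> module.span smul B = UNIV)"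

text \<open>Sequences are indexed from 0 instead of 1.\<close>

definition frame :: "('h::real_normed_vector \<Rightarrow> 'h \<Rightarrow> 'k::real_normed_field) \<Rightarrow> (nat \<Rightarrow> 'h) \<Rightarrow> bool"
  where
  "frame ip f \<longleftrightarrow> (\<exists>A>0. \<exists>B>0. \<forall>x.
     summable (\<lambda>n. (norm (ip x (f n)))\<^sup>2) \<and>
     A * (norm x)\<^sup>2 \<le> (\<Sum>n. (norm (ip x (f n)))\<^sup>2) \<and>
     (\<Sum>n. (norm (ip x (f n)))\<^sup>2) \<le> B * (norm x)\<^sup>2)"

definition l2 :: "(nat \<Rightarrow> 'k::real_normed_field) set" where
  "l2 = {c. summable (\<lambda>n. (norm (c n))\<^sup>2)}"

definition l2_inner :: "(nat \<Rightarrow> 'k::real_or_complex) \<Rightarrow> (nat \<Rightarrow> 'k) \<Rightarrow> 'k" where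
  "l2_inner c d = (\<Sum>n. c n * conj (d n))"

definition analysis :: "('h \<Rightarrow> 'h \<Rightarrow> 'k) \<Rightarrow> (nat \<Rightarrow> 'h) \<Rightarrow> 'h \<Rightarrow> (nat \<Rightarrow> 'k)" where
  "analysis ip f x = (\<lambda>n. ip x (f n))"

lemma analysis_in_l2: "frame ip f \<Longrightarrow> analysis ip f x \<in> l2"
  by (auto simp: frame_def analysis_def l2_def)

text \<open>
  The Hilbert space adjoint of an operator \<open>T\<close> from the space into \<open>l2\<close>; the value is
  meaningful for bounded linear \<open>T\<close> and \<open>c \<in> l2\<close>.
\<close>

definition l2_adjoint ::
  "('h \<Rightarrow> 'h \<Rightarrow> 'k::real_or_complex) \<Rightarrow> ('h \<Rightarrow> nat \<Rightarrow> 'k) \<Rightarrow> (nat \<Rightarrow> 'k) \<Rightarrow> 'h" where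
  "l2_adjoint ip T c = (THE y. \<forall>x. ip y x = l2_inner c (T x))"

definition bounded_operator ::
  "('k::field \<Rightarrow> 'h::real_normed_vector \<Rightarrow> 'h) \<Rightarrow> ('h \<Rightarrow> 'h) \<Rightarrow> bool" where
  "bounded_operator smul T \<longleftrightarrow>
     Vector_Spaces.linear smul smul T \<and> (\<exists>K. \<forall>x. norm (T x) \<le> norm x * K)"

definition invertible_operator ::
  "('k::field \<Rightarrow> 'h::real_normed_vector \<Rightarrow> 'h) \<Rightarrow> ('h \<Rightarrow> 'h) \<Rightarrow> bool" where
  "invertible_operator smul T \<longleftrightarrow> bounded_operator smul T \<and>
     (\<exists>S. bounded_operator smul S \<and> S \<circ> T = id \<and> T \<circ> S = id)"

definition pseudo_dual ::
  "('k::real_or_complex \<Rightarrow> 'h::real_normed_vector \<Rightarrow> 'h) \<Rightarrow> ('h \<Rightarrow> 'h \<Rightarrow> 'k) \<Rightarrow>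
   (nat \<Rightarrow> 'h) \<Rightarrow> (nat \<Rightarrow> 'h) \<Rightarrow> bool" where
  "pseudo_dual smul ip f g \<longleftrightarrow>
     invertible_operator smul (l2_adjoint ip (analysis ip g) \<circ> analysis ip f)"

definition approximately_dual ::
  "('h::real_normed_vector \<Rightarrow> 'h \<Rightarrow> 'k::real_or_complex) \<Rightarrow>
   (nat \<Rightarrow> 'h) \<Rightarrow> (nat \<Rightarrow> 'h) \<Rightarrow> bool" where
  "approximately_dual ip f g \<longleftrightarrow>
     onorm (\<lambda>x. (l2_adjoint ip (analysis ip g) \<circ> analysis ip f) x - x) < 1"

definition complete_set ::
  "('k::field \<Rightarrow> 'h::real_normed_vector \<Rightarrow> 'h) \<Rightarrow> 'h set \<Rightarrow> bool" where
  "complete_set smul S \<longleftrightarrow> closure (module.span smul S) = UNIV"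

text \<open>
  Elements are deleted by index, so repeated vectors count separately. The supremum in
  \<^typ>\<open>enat\<close> of a set of naturals is its greatest element if it is nonempty and bounded, and
  \<open>\<infinity>\<close> if it is unbounded; for a frame, \<open>k = 0\<close> always belongs to the set.
\<close>

definition excess ::
  "('k::field \<Rightarrow> 'h::real_normed_vector \<Rightarrow> 'h) \<Rightarrow> (nat \<Rightarrow> 'h) \<Rightarrow> enat" where
  "excess smul f =
     Sup {enat k |k. \<exists>J. finite J \<and> card J = k \<and> complete_set smul (f ` (- J))}"

end

theory Submission
  imports Defs "HOL-Library.Function_Algebras"
begin

text \<open>
  Let \<open>U\<close> and \<open>V\<close> be the analysis operators of \<open>f\<close> and \<open>g\<close>. Deleting the elements with indices in
  a finite set \<open>J\<close> leaves \<open>f\<close> complete only if no nonzero \<open>U x\<close> is supported in \<open>J\<close>, so such a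
  \<open>J\<close> of size \<open>k\<close> shows that the range of \<open>U\<close> has codimension at least \<open>k\<close> in \<open>l2\<close>. On the other
  side, \<open>k\<close> independent vectors in the kernel of \<open>V\<^sup>*\<close> are \<open>k\<close> independent linear relations
  between the \<open>g n\<close>, and they allow \<open>k\<close> of the \<open>g n\<close> to be expressed by the others. If \<open>V\<^sup>*U\<close> is
  invertible, then \<open>l2\<close> is the direct sum of the range of \<open>U\<close> and the kernel of \<open>V\<^sup>*\<close>, so the two
  dimensions agree.

  Surjectivity of \<open>V\<^sup>*U\<close> gives \<open>excess f \<le> excess g\<close>
  (\<open>excess_le_if_surj_mixed_op\<close>): choose \<open>z j\<close> with \<open>V\<^sup>*U (z j) = g j\<close>. For a unit vector \<open>e j\<close>
  of \<open>l2\<close> we have \<open>V\<^sup>*(e j) = g j\<close>, so \<open>d j = e j - U (z j)\<close> lies in the kernel of \<open>V\<^sup>*\<close>, and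
  it differs from \<open>e j\<close> by an element of the range of \<open>U\<close>. Hence the \<open>d j\<close> with \<open>j \<in> J\<close> are
  independent. As row rank equals column rank (\<open>exists_dual_coordinates\<close>), there are \<open>k\<close>
  coordinates \<open>N\<close> on which combinations of the \<open>d j\<close> take the values of the unit vectors; each such
  combination writes one \<open>g i\<close> with \<open>i \<in> N\<close> as an infinite combination of the \<open>g n\<close> with
  \<open>n \<notin> N\<close>. Since \<open>V\<^sup>*U\<close> is onto, every vector is a series in the \<open>g n\<close>, so the \<open>g n\<close> with
  \<open>n \<notin> N\<close> are complete.

  The reverse inequality needs surjectivity of \<open>U\<^sup>*V\<close>, the adjoint of \<open>V\<^sup>*U\<close>. Both kinds of
  duality make both operators bounded below, and a bounded operator is onto if its adjoint is bounded
  below (\<open>surj_if_adjoint_bounded_below\<close>).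
\<close>

section \<open>Coordinates dual to an independent family\<close>

interpretation coord: vector_space "\<lambda>(a::'k::field) (c::'n \<Rightarrow> 'k) n. a * c n"
  by unfold_locales (auto simp: fun_eq_iff algebra_simps)

text \<open>
  Row rank equals column rank, for vectors with arbitrarily many coordinates: Gaussian elimination
  finds as many pivot coordinates as there are independent vectors. Independence is expressed by
  \<open>d j \<notin> span (d ` (J - {j}))\<close>, which also forces \<open>d\<close> to be injective on \<open>J\<close>.
\<close>

lemma exists_dual_coordinates:
  fixes d :: "'j \<Rightarrow> 'n \<Rightarrow> 'k::field"
  assumes "finite J" and "\<And>j. j \<in> J \<Longrightarrow> d j \<notin> coord.span (d ` (J - {j}))"
  shows "\<exists>N. finite N \<and> card N = card J \<and>
    (\<forall>i\<in>N. \<exists>c\<in>coord.span (d ` J). \<forall>n\<in>N. c n = (if n = i then 1 else 0))"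
  using assms
proof (induction J rule: finite_induct)
  case empty
  then show ?case by (intro exI[of _ "{}"]) auto
next
  case (insert j J)
  have "d l \<notin> coord.span (d ` (J - {l}))" if "l \<in> J" for l
    using insert.prems[of l] that coord.span_mono[of "d ` (J - {l})" "d ` (insert j J - {l})"]
    by blast
  then obtain N where N: "finite N" "card N = card J"
    and "\<forall>i\<in>N. \<exists>c\<in>coord.span (d ` J). \<forall>n\<in>N. c n = (if n = i then 1 else 0)"
    using insert.IH by blast
  then obtain c where c: "\<And>i. i \<in> N \<Longrightarrow> c i \<in> coord.span (d ` J)"
    "\<And>i n. i \<in> N \<Longrightarrow> n \<in> N \<Longrightarrow> c i n = (if n = i then 1 else 0)"
    by metis
  let ?S = "coord.span (d ` insert j J)"
  have sub: "coord.span (d ` J) \<subseteq> ?S"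
    by (intro coord.span_mono) auto
  \<comment> \<open>\<open>p\<close> agrees with the new vector on the old pivots but not everywhere, so their difference
    supplies the new pivot.\<close>
  define p where "p = (\<Sum>i\<in>N. (\<lambda>n. d j i * c i n))"
  have p: "p \<in> coord.span (d ` J)"
    unfolding p_def by (intro coord.span_sum coord.span_scale c)
  have p_app: "p n = (\<Sum>i\<in>N. d j i * c i n)" for n
    unfolding p_def by (induction N rule: infinite_finite_induct) auto
  have p_N: "p n = d j n" if "n \<in> N" for n
  proof -
    have "p n = (\<Sum>i\<in>N. if n = i then d j i else 0)"
      unfolding p_app using c that by (intro sum.cong) auto
    then show ?thesis using N that by simp
  qed
  have "insert j J - {j} = J" using insert.hyps by auto
  then have "d j \<notin> coord.span (d ` J)"
    using insert.prems[of j] by simp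
  then have "d j \<noteq> p" using p by blast
  then obtain m where m: "d j m \<noteq> p m" by auto
  have mN: "m \<notin> N" using m p_N by metis
  define r where "r = (\<lambda>n. inverse (d j m - p m) * (d j - p) n)"
  have "d j \<in> ?S" by (intro coord.span_base) auto
  then have r: "r \<in> ?S"
    unfolding r_def using p sub by (intro coord.span_scale coord.span_diff) auto
  have r_val: "r m = 1" "\<And>n. n \<in> N \<Longrightarrow> r n = 0"
    using m p_N by (auto simp: r_def)
  have "\<exists>x\<in>?S. \<forall>n\<in>insert m N. x n = (if n = i then 1 else 0)" if i: "i \<in> insert m N" for i
  proof (cases "i = m")
    case True
    then show ?thesis using r r_val mN by (intro bexI[of _ r]) auto
  next
    case False
    then have iN: "i \<in> N" using i by simp
    have "c i - (\<lambda>n. c i m * r n) \<in> ?S"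
      using c(1)[OF iN] sub r by (intro coord.span_diff coord.span_scale) auto
    then show ?thesis
      using iN c(2)[OF iN] r_val mN False
      by (intro bexI[of _ "c i - (\<lambda>n. c i m * r n)"]) auto
  qed
  moreover have "card (insert m N) = card (insert j J)"
    using N mN insert.hyps by simp
  ultimately show ?case
    using N by (intro exI[of _ "insert m N"]) auto
qed

section \<open>Geometry of the inner product\<close>

lemma conj_zero [simp]: "conj 0 = (0::'k::real_or_complex)"
  using conj_add[of "0::'k" 0] by simp

lemma norm_conj [simp]: "norm (conj x) = norm (x::'k::real_or_complex)"
proof (cases "x = 0")
  case False
  have "norm x * norm (conj x) = norm x * norm x"
    using arg_cong[OF mult_conj[of x], of norm] by (simp add: norm_mult power2_eq_square)
  then show ?thesis using False by simp
qed simp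

lemma conj_of_real [simp]: "conj (of_real r) = (of_real r :: 'k::real_or_complex)"
proof (cases "r = 0")
  case False
  have "(of_real r :: 'k) * conj (of_real r) = of_real r * of_real r"
    using mult_conj[of "of_real r :: 'k"] by (simp add: scaleR_conv_of_real power2_eq_square)
  then show ?thesis using False by simp
qed simp

context hilbert_space
begin

lemma norm_ip_self: "norm (ip x x) = (norm x)\<^sup>2"
  by (simp add: inner_self del: of_real_power)

lemma ip_add_right: "ip x (y + z) = ip x y + ip x z"
  by (metis inner_add_left inner_commute conj_add)

lemma ip_scale_right: "ip x (smul a y) = conj a * ip x y"
  by (metis inner_scale_left inner_commute conj_mult)

lemma ip_scaleR_left: "ip (r *\<^sub>R x) y = r *\<^sub>R ip x y"
  by (metis scale_of_real inner_scale_left scaleR_conv_of_real)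

lemma ip_scaleR_right: "ip x (r *\<^sub>R y) = r *\<^sub>R ip x y"
  by (metis scale_of_real ip_scale_right conj_of_real scaleR_conv_of_real)

lemma ip_zero_left [simp]: "ip 0 y = 0"
  using inner_add_left[of 0 0 y] by simp

lemma ip_zero_right [simp]: "ip x 0 = 0"
  using ip_add_right[of x 0 0] by simp

lemma ip_diff_left: "ip (x - y) z = ip x z - ip y z"
  using inner_add_left[of "x - y" y z] by simp

lemma ip_diff_right: "ip x (y - z) = ip x y - ip x z"
  using ip_add_right[of x "y - z" z] by simp

lemma ip_sum_left: "ip (sum h F) y = (\<Sum>i\<in>F. ip (h i) y)"
  by (induction F rule: infinite_finite_induct) (auto simp: inner_add_left)

lemma norm_smul: "norm (smul a x) = norm a * norm x"
proof -
  have "(of_real ((norm (smul a x))\<^sup>2) :: 'k) = a * conj a * ip x x"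
    unfolding inner_self[symmetric] by (simp add: inner_scale_left ip_scale_right)
  also have "\<dots> = of_real ((norm a * norm x)\<^sup>2)"
    by (simp add: mult_conj inner_self scaleR_conv_of_real power_mult_distrib)
  finally have "(norm (smul a x))\<^sup>2 = (norm a * norm x)\<^sup>2"
    using of_real_eq_iff by blast
  then show ?thesis by (simp add: power2_eq_iff_nonneg)
qed

text \<open>
  Up to a factor, \<open>w\<close> below is the component of \<open>x\<close> orthogonal to \<open>y\<close>; the inequality says that
  its norm is nonnegative.
\<close>

lemma ip_cauchy_schwarz: "norm (ip x y) \<le> norm x * norm y"
proof (cases "y = 0")
  case False
  define s where "s = (norm y)\<^sup>2"
  have s: "s > 0" using False by (simp add: s_def)
  define w where "w = s *\<^sub>R x - smul (ip x y) y"
  have y: "ip y y = of_real s" by (simp add: s_def inner_self)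
  have wy: "ip w y = 0"
    by (simp add: w_def ip_diff_left ip_scaleR_left inner_scale_left y scaleR_conv_of_real)
  have "(of_real ((norm w)\<^sup>2) :: 'k) = ip w (s *\<^sub>R x) - conj (ip x y) * ip w y"
    unfolding inner_self[symmetric] by (subst (2) w_def) (simp add: ip_diff_right ip_scale_right)
  also have "\<dots> = of_real s * (of_real s * ip x x - ip x y * conj (ip x y))"
    unfolding wy
    by (simp add: w_def ip_scaleR_right ip_diff_left ip_scaleR_left inner_scale_left
      scaleR_conv_of_real inner_commute[of y x])
  also have "\<dots> = of_real (s * (s * (norm x)\<^sup>2 - (norm (ip x y))\<^sup>2))"
    by (simp add: inner_self mult_conj scaleR_conv_of_real)
  finally have "(norm w)\<^sup>2 = s * (s * (norm x)\<^sup>2 - (norm (ip x y))\<^sup>2)"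
    using of_real_eq_iff by blast
  then have "0 \<le> s * (s * (norm x)\<^sup>2 - (norm (ip x y))\<^sup>2)"
    by (metis zero_le_power2)
  then have "(norm (ip x y))\<^sup>2 \<le> (norm x * norm y)\<^sup>2"
    using s by (simp add: zero_le_mult_iff s_def power_mult_distrib mult.commute)
  then show ?thesis by (rule power2_le_imp_le) simp
qed simp

lemma bounded_linear_ip_left: "bounded_linear (\<lambda>x. ip x y)"
  by (rule bounded_linear_intro[of _ "norm y"])
    (auto simp: inner_add_left ip_scaleR_left ip_cauchy_schwarz)

lemma bounded_linear_ip_right: "bounded_linear (ip x)"
  by (rule bounded_linear_intro[of _ "norm x"])
    (auto simp: ip_add_right ip_scaleR_right ip_cauchy_schwarz mult.commute[of _ "norm x"])

lemma bounded_linear_smul_right: "bounded_linear (smul a)"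
  by (rule bounded_linear_intro[of _ "norm a"])
    (auto simp: scale_right_distrib norm_smul scale_of_real[symmetric] mult.commute)

lemma ip_left_eqI:
  assumes "\<And>z. ip x z = ip y z"
  shows "x = y"
proof -
  have "ip (x - y) (x - y) = 0" by (simp add: ip_diff_left assms)
  then show ?thesis by (simp add: inner_self)
qed

lemma subspace_closure:
  assumes "subspace S"
  shows "subspace (closure S)"
proof (rule subspaceI)
  show "0 \<in> closure S" using subspace_0[OF assms] closure_subset by blast
next
  fix x y assume "x \<in> closure S" "y \<in> closure S"
  then obtain u v where "\<And>n. u n \<in> S" "u \<longlonglongrightarrow> x" "\<And>n. v n \<in> S" "v \<longlonglongrightarrow> y"
    unfolding closure_sequential by blast
  then show "x + y \<in> closure S"
    unfolding closure_sequential using subspace_add[OF assms]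
    by (intro exI[of _ "\<lambda>n. u n + v n"]) (auto intro: tendsto_add)
next
  fix a x assume "x \<in> closure S"
  then obtain u where "\<And>n. u n \<in> S" "u \<longlonglongrightarrow> x"
    unfolding closure_sequential by blast
  then show "smul a x \<in> closure S"
    unfolding closure_sequential using subspace_scale[OF assms]
    by (intro exI[of _ "\<lambda>n. smul a (u n)"])
      (auto intro: bounded_linear.tendsto[OF bounded_linear_smul_right])
qed

lemma complete_set_orthogonal_eq_0:
  assumes "complete_set smul S" and "\<And>s. s \<in> S \<Longrightarrow> ip x s = 0"
  shows "x = 0"
proof -
  have "subspace {y. ip x y = 0}"
    by (auto intro!: subspaceI simp: ip_add_right ip_scale_right)
  then have "span S \<subseteq> {y. ip x y = 0}"
    using assms(2) by (intro span_minimal) auto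
  moreover have "closed {y. ip x y = 0}"
    by (intro closed_Collect_eq linear_continuous_on bounded_linear_ip_right continuous_on_const)
  ultimately have "closure (span S) \<subseteq> {y. ip x y = 0}"
    by (rule closure_minimal)
  then have "ip x x = 0" using assms(1) unfolding complete_set_def by blast
  then show ?thesis by (simp add: inner_self)
qed

section \<open>Surjectivity from a lower bound on the adjoint\<close>

text \<open>
  Since \<open>T'\<close> is bounded below, \<open>T T'\<close> is positive definite, so \<open>z \<mapsto> z - \<omega> (T (T' z) - y)\<close>
  is a contraction for small \<open>\<omega> > 0\<close>, and \<open>T\<close> maps \<open>T' z\<close> to \<open>y\<close> at its fixed point \<open>z\<close>.
\<close>

lemma surj_if_adjoint_bounded_below:
  assumes T: "bounded_linear T" and T': "bounded_linear T'"
    and adj: "\<And>x y. ip (T x) y = ip x (T' y)"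
    and m: "m > 0" and below: "\<And>y. m * norm y \<le> norm (T' y)"
  shows "surj T"
proof -
  interpret T: bounded_linear T by fact
  interpret T': bounded_linear T' by fact
  \<comment> \<open>Adding \<open>m\<close> to the operator norm gives \<open>0 < m / M \<le> 1\<close>, so that the square root in \<open>q\<close> is real.\<close>
  define M where "M = onorm T + m"
  have M: "M > 0" "m \<le> M" using m onorm_pos_le[OF T] by (auto simp: M_def)
  have TM: "norm (T x) \<le> M * norm x" for x
    using onorm[OF T, of x] m mult_right_mono[of "onorm T" M "norm x"] by (simp add: M_def)
  define \<omega> where "\<omega> = 1 / M\<^sup>2"
  define q where "q = sqrt (1 - (m / M)\<^sup>2)"
  have mM: "0 < m / M" "m / M \<le> 1" using M m by auto
  then have mM2: "(m / M)\<^sup>2 \<le> 1" "0 < (m / M)\<^sup>2" by (auto simp: power_le_one)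
  have q: "0 \<le> q" "q < 1" using mM2 by (auto simp: q_def)
  have contr: "norm (w - \<omega> *\<^sub>R T (T' w)) \<le> q * norm w" for w
  proof -
    let ?b = "\<omega> *\<^sub>R T (T' w)"
    have bw: "ip ?b w = of_real (\<omega> * (norm (T' w))\<^sup>2)"
      by (simp add: ip_scaleR_left adj inner_self scaleR_conv_of_real)
    then have wb: "ip w ?b = of_real (\<omega> * (norm (T' w))\<^sup>2)"
      using inner_commute[of w ?b] conj_of_real by metis
    have "(of_real ((norm (w - ?b))\<^sup>2) :: 'k) = ip w w - ip w ?b - (ip ?b w - ip ?b ?b)"
      unfolding inner_self[symmetric] ip_diff_left ip_diff_right by simp
    also have "\<dots> = of_real ((norm w)\<^sup>2 - 2 * \<omega> * (norm (T' w))\<^sup>2 + (norm ?b)\<^sup>2)"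
      unfolding bw wb inner_self by simp
    finally have eq: "(norm (w - ?b))\<^sup>2 = (norm w)\<^sup>2 - 2 * \<omega> * (norm (T' w))\<^sup>2 + (norm ?b)\<^sup>2"
      using of_real_eq_iff by blast
    have "(norm ?b)\<^sup>2 \<le> (\<omega> * (M * norm (T' w)))\<^sup>2"
      using TM[of "T' w"] by (intro power_mono) (auto simp: \<omega>_def intro!: divide_right_mono)
    also have "\<dots> = \<omega> * (norm (T' w))\<^sup>2"
      using M by (simp add: \<omega>_def power2_eq_square)
    finally have "(norm (w - ?b))\<^sup>2 \<le> (norm w)\<^sup>2 - \<omega> * (norm (T' w))\<^sup>2"
      using eq by simp
    also have "\<dots> \<le> (norm w)\<^sup>2 - \<omega> * (m * norm w)\<^sup>2"
      using power_mono[OF below[of w], of 2] m by (simp add: \<omega>_def divide_right_mono)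
    also have "\<dots> = (q * norm w)\<^sup>2"
      using mM2 by (simp add: q_def \<omega>_def power_mult_distrib power_divide algebra_simps)
    finally show ?thesis
      by (rule power2_le_imp_le) (use q in simp)
  qed
  have "\<exists>x. T x = y" for y
  proof -
    define \<Phi> where "\<Phi> z = z - \<omega> *\<^sub>R (T (T' z) - y)" for z
    have "\<exists>!z. \<Phi> z = z"
    proof (rule banach_fix_type[OF q], intro allI)
      fix a b
      have "\<Phi> a - \<Phi> b = (a - b) - \<omega> *\<^sub>R T (T' (a - b))"
        by (simp add: \<Phi>_def T.diff T'.diff algebra_simps)
      then show "dist (\<Phi> a) (\<Phi> b) \<le> q * dist a b"
        using contr[of "a - b"] by (simp add: dist_norm)
    qed
    then obtain z where "\<Phi> z = z" by blast
    then have "T (T' z) = y" using M by (simp add: \<Phi>_def \<omega>_def)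
    then show ?thesis by blast
  qed
  then show ?thesis by (metis surjI)
qed

section \<open>Mixed frame operators\<close>

text \<open>
  This is \<open>V\<^sup>*U\<close>, where \<open>U\<close> and \<open>V\<close> are the analysis operators of \<open>f\<close> and \<open>g\<close>
  (\<open>l2_adjoint_analysis\<close>). The series makes \<open>U x\<close> available as a sequence of coefficients with
  respect to \<open>g\<close>.
\<close>

definition mixed_op :: "(nat \<Rightarrow> 'h) \<Rightarrow> (nat \<Rightarrow> 'h) \<Rightarrow> 'h \<Rightarrow> 'h" where
  "mixed_op f g x = (\<Sum>n. smul (ip x (f n)) (g n))"

definition bessel_bound :: "(nat \<Rightarrow> 'h) \<Rightarrow> real \<Rightarrow> bool" where
  "bessel_bound f B \<longleftrightarrow> B > 0 \<and> (\<forall>x. summable (\<lambda>n. (norm (ip x (f n)))\<^sup>2) \<and>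
     (\<Sum>n. (norm (ip x (f n)))\<^sup>2) \<le> B * (norm x)\<^sup>2)"

lemma frame_bessel_bound:
  assumes "frame ip f"
  obtains B where "bessel_bound f B"
proof -
  obtain B where "B > 0" "\<forall>x. summable (\<lambda>n. (norm (ip x (f n)))\<^sup>2) \<and>
      (\<Sum>n. (norm (ip x (f n)))\<^sup>2) \<le> B * (norm x)\<^sup>2"
    using assms unfolding frame_def by auto
  then show thesis by (intro that[of B]) (simp add: bessel_bound_def)
qed

text \<open>
  The synthesis operator has the norm of its adjoint, the analysis operator: for
  \<open>w = (\<Sum>n\<in>F. smul (c n) (g n))\<close>, apply the Cauchy-Schwarz inequality to
  \<open>ip w w = (\<Sum>n\<in>F. c n * ip (g n) w)\<close>.
\<close>

lemma bessel_synthesis_bound: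
  assumes g: "bessel_bound g B" and F: "finite F"
  shows "(norm (\<Sum>n\<in>F. smul (c n) (g n)))\<^sup>2 \<le> B * (\<Sum>n\<in>F. (norm (c n))\<^sup>2)"
proof (cases "(\<Sum>n\<in>F. smul (c n) (g n)) = 0")
  case True
  then show ?thesis using g by (simp add: bessel_bound_def sum_nonneg)
next
  case False
  define w where "w = (\<Sum>n\<in>F. smul (c n) (g n))"
  define C where "C = (\<Sum>n\<in>F. (norm (c n))\<^sup>2)"
  have B: "B > 0" using g by (simp add: bessel_bound_def)
  have G: "(\<Sum>n\<in>F. (norm (ip w (g n)))\<^sup>2) \<le> B * (norm w)\<^sup>2"
    using g sum_le_suminf[of "\<lambda>n. (norm (ip w (g n)))\<^sup>2" F] F
    unfolding bessel_bound_def by (meson order_trans zero_le_power2)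
  have "(norm w)\<^sup>2 = norm (ip w w)" by (simp add: norm_ip_self)
  also have "ip w w = (\<Sum>n\<in>F. c n * ip (g n) w)"
    by (subst (1) w_def) (simp add: ip_sum_left inner_scale_left)
  also have "norm \<dots> \<le> (\<Sum>n\<in>F. norm (c n) * norm (ip w (g n)))"
    by (rule order_trans[OF norm_sum]) (simp add: norm_mult inner_commute[of _ w])
  finally have "((norm w)\<^sup>2)\<^sup>2 \<le> (\<Sum>n\<in>F. norm (c n) * norm (ip w (g n)))\<^sup>2"
    by (intro power_mono) auto
  also have "\<dots> \<le> C * (\<Sum>n\<in>F. (norm (ip w (g n)))\<^sup>2)"
    unfolding C_def by (rule Cauchy_Schwarz_ineq_sum)
  also have "\<dots> \<le> C * (B * (norm w)\<^sup>2)"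
    by (intro mult_left_mono G) (simp add: C_def sum_nonneg)
  finally have "(norm w)\<^sup>2 * (norm w)\<^sup>2 \<le> (B * C) * (norm w)\<^sup>2"
    by (simp add: power2_eq_square mult_ac)
  then have "(norm w)\<^sup>2 \<le> B * C"
    using False by (simp only: mult_le_cancel_right) (simp add: w_def)
  then show ?thesis by (simp add: w_def C_def)
qed

lemma bessel_synthesis_summable:
  assumes g: "bessel_bound g B" and c: "summable (\<lambda>n. (norm (c n))\<^sup>2)"
  shows "summable (\<lambda>n. smul (c n) (g n))"
  unfolding summable_Cauchy
proof (intro allI impI)
  fix e :: real assume e: "e > 0"
  have B: "B > 0" using g by (simp add: bessel_bound_def)
  from c[unfolded summable_Cauchy, rule_format, of "e\<^sup>2 / B"]
  obtain N where N: "\<And>m n. m \<ge> N \<Longrightarrow> norm (\<Sum>i=m..<n. (norm (c i))\<^sup>2) < e\<^sup>2 / B"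
    using e B by auto
  have "norm (\<Sum>i=m..<n. smul (c i) (g i)) < e" if "m \<ge> N" for m n
  proof -
    have "(norm (\<Sum>i=m..<n. smul (c i) (g i)))\<^sup>2 \<le> B * (\<Sum>i=m..<n. (norm (c i))\<^sup>2)"
      by (rule bessel_synthesis_bound[OF g]) simp
    also have "\<dots> < e\<^sup>2"
      using N[OF that, of n] B by (simp add: sum_nonneg field_simps)
    finally show ?thesis by (rule power_less_imp_less_base) (use e in simp)
  qed
  then show "\<exists>N. \<forall>m\<ge>N. \<forall>n. norm (\<Sum>i=m..<n. smul (c i) (g i)) < e" by blast
qed

context
  fixes f g :: "nat \<Rightarrow> 'h" and A B :: real
  assumes f: "bessel_bound f A" and g: "bessel_bound g B"
begin

lemma mixed_op_sums: "(\<lambda>n. smul (ip x (f n)) (g n)) sums mixed_op f g x"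
  unfolding mixed_op_def
  using bessel_synthesis_summable[OF g] f by (intro summable_sums) (auto simp: bessel_bound_def)

lemma bounded_linear_mixed_op: "bounded_linear (mixed_op f g)"
proof (rule bounded_linear_intro[of _ "sqrt (A * B)"])
  fix x y
  have "(\<lambda>n. smul (ip (x + y) (f n)) (g n)) sums (mixed_op f g x + mixed_op f g y)"
    using sums_add[OF mixed_op_sums[of x] mixed_op_sums[of y]]
    by (simp add: inner_add_left scale_left_distrib)
  then show "mixed_op f g (x + y) = mixed_op f g x + mixed_op f g y"
    using mixed_op_sums sums_unique2 by blast
next
  fix r x
  have "smul (ip (r *\<^sub>R x) (f n)) (g n) = r *\<^sub>R smul (ip x (f n)) (g n)" for n
    unfolding ip_scaleR_left by (simp add: scaleR_conv_of_real flip: scale_of_real)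
  then show "mixed_op f g (r *\<^sub>R x) = r *\<^sub>R mixed_op f g x"
    using sums_unique2[OF mixed_op_sums[of "r *\<^sub>R x"]] sums_scaleR_right[OF mixed_op_sums[of x], of r]
    by simp
next
  fix x
  have A: "A > 0" and B: "B > 0"
    using f g by (auto simp: bessel_bound_def)
  have "(norm (\<Sum>n<N. smul (ip x (f n)) (g n)))\<^sup>2 \<le> A * B * (norm x)\<^sup>2" for N
  proof -
    have "(norm (\<Sum>n<N. smul (ip x (f n)) (g n)))\<^sup>2 \<le> B * (\<Sum>n<N. (norm (ip x (f n)))\<^sup>2)"
      by (rule bessel_synthesis_bound[OF g]) simp
    also have "(\<Sum>n<N. (norm (ip x (f n)))\<^sup>2) \<le> (\<Sum>n. (norm (ip x (f n)))\<^sup>2)"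
      using f by (intro sum_le_suminf) (auto simp: bessel_bound_def)
    also have "\<dots> \<le> A * (norm x)\<^sup>2" using f by (simp add: bessel_bound_def)
    finally show ?thesis using B by (simp add: mult_ac)
  qed
  then have "norm (\<Sum>n<N. smul (ip x (f n)) (g n)) \<le> sqrt (A * B * (norm x)\<^sup>2)" for N
    by (rule real_le_rsqrt)
  then have partial: "norm (\<Sum>n<N. smul (ip x (f n)) (g n)) \<le> norm x * sqrt (A * B)" for N
    by (simp add: real_sqrt_mult mult.commute)
  then show "norm (mixed_op f g x) \<le> norm x * sqrt (A * B)"
    using LIMSEQ_le_const2[OF tendsto_norm[OF mixed_op_sums[of x, unfolded sums_def]]] by blast
qed

lemma ip_mixed_op_sums: "(\<lambda>n. ip x (f n) * conj (ip y (g n))) sums ip (mixed_op f g x) y"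
  using bounded_linear.sums[OF bounded_linear_ip_left[of y] mixed_op_sums[of x]]
  by (simp add: inner_scale_left inner_commute[symmetric])

lemma l2_adjoint_analysis:
  "l2_adjoint ip (analysis ip g) \<circ> analysis ip f = mixed_op f g"
proof
  fix x
  have eq: "ip (mixed_op f g x) y = l2_inner (analysis ip f x) (analysis ip g y)" for y
    using ip_mixed_op_sums[of x y] by (simp add: l2_inner_def analysis_def sums_iff)
  show "(l2_adjoint ip (analysis ip g) \<circ> analysis ip f) x = mixed_op f g x"
    unfolding l2_adjoint_def comp_def
    by (rule the_equality) (auto simp: eq intro!: ip_left_eqI)
qed

end

lemma mixed_op_adjoint:
  assumes f: "bessel_bound f A" and g: "bessel_bound g B"
  shows "ip (mixed_op f g x) y = ip x (mixed_op g f y)"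
proof -
  have "(\<lambda>n. ip x (f n) * conj (ip y (g n))) sums ip x (mixed_op g f y)"
    using bounded_linear.sums[OF bounded_linear_ip_right[of x] mixed_op_sums[OF g f, of y]]
    by (simp add: ip_scale_right mult.commute)
  then show ?thesis
    using ip_mixed_op_sums[OF f g] sums_unique2 by blast
qed

lemma surj_mixed_ops:
  assumes f: "bessel_bound f A" and g: "bessel_bound g B" and m: "m > 0"
    and "\<And>x. m * norm x \<le> norm (mixed_op f g x)"
    and "\<And>x. m * norm x \<le> norm (mixed_op g f x)"
  shows "surj (mixed_op f g)" and "surj (mixed_op g f)"
  using surj_if_adjoint_bounded_below[OF bounded_linear_mixed_op[OF f g]
      bounded_linear_mixed_op[OF g f] mixed_op_adjoint[OF f g] m]
    surj_if_adjoint_bounded_below[OF bounded_linear_mixed_op[OF g f]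
      bounded_linear_mixed_op[OF f g] mixed_op_adjoint[OF g f] m] assms by blast+

text \<open>
  A bounded inverse \<open>S\<close> of \<open>T = V\<^sup>*U\<close> bounds \<open>T\<close> from below, and it does the same for the adjoint
  \<open>T'\<close> because \<open>ip x x = ip (T (S x)) x = ip (S x) (T' x)\<close>.
\<close>

lemma pseudo_dual_surj:
  assumes f: "bessel_bound f A" and g: "bessel_bound g B" and "pseudo_dual smul ip f g"
  shows "surj (mixed_op f g)" and "surj (mixed_op g f)"
proof -
  let ?T = "mixed_op f g" and ?T' = "mixed_op g f"
  obtain S K where S: "S \<circ> ?T = id" "?T \<circ> S = id" and K: "\<And>x. norm (S x) \<le> norm x * K"
    using assms(3) unfolding pseudo_dual_def l2_adjoint_analysis[OF f g]
      invertible_operator_def bounded_operator_def by blast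
  define L where "L = max K 1"
  have L: "L > 0" by (simp add: L_def)
  have SL: "norm (S x) \<le> L * norm x" for x
  proof -
    have "norm x * K \<le> norm x * L" by (intro mult_left_mono) (auto simp: L_def)
    then show ?thesis using K[of x] by (simp add: mult.commute)
  qed
  have "norm x \<le> L * norm (?T x)" for x
    using SL[of "?T x"] S(1) by (simp add: fun_eq_iff)
  then have 1: "(1 / L) * norm x \<le> norm (?T x)" for x
    using L by (simp add: field_simps)
  have 2: "(1 / L) * norm x \<le> norm (?T' x)" for x
  proof -
    have "ip x x = ip (S x) (?T' x)"
      using mixed_op_adjoint[OF f g, of "S x" x] S(2) by (simp add: fun_eq_iff)
    then have "(norm x)\<^sup>2 \<le> norm (S x) * norm (?T' x)"
      using ip_cauchy_schwarz[of "S x" "?T' x"] norm_ip_self[of x] by simp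
    also have "\<dots> \<le> L * norm x * norm (?T' x)"
      by (intro mult_right_mono SL) simp
    finally have "norm x * norm x \<le> norm x * (L * norm (?T' x))"
      by (simp add: power2_eq_square mult_ac)
    then have "norm x \<le> L * norm (?T' x)"
      using L by (cases "x = 0") auto
    then show ?thesis using L by (simp add: field_simps)
  qed
  show "surj ?T" "surj ?T'"
    using surj_mixed_ops[OF f g _ 1 2] L by auto
qed

text \<open>
  If \<open>T - I\<close> has norm \<open>q < 1\<close>, then so has its adjoint \<open>T' - I\<close>, and both \<open>T\<close> and \<open>T'\<close>
  are bounded below by \<open>1 - q\<close>.
\<close>

lemma approximately_dual_surj:
  assumes f: "bessel_bound f A" and g: "bessel_bound g B" and "approximately_dual ip f g"
  shows "surj (mixed_op f g)" and "surj (mixed_op g f)"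
proof -
  let ?T = "mixed_op f g" and ?T' = "mixed_op g f"
  define q where "q = onorm (\<lambda>x. ?T x - x)"
  have q: "q < 1"
    using assms(3) unfolding approximately_dual_def l2_adjoint_analysis[OF f g] q_def .
  have Tq: "norm (?T x - x) \<le> q * norm x" for x
    unfolding q_def
    by (intro onorm bounded_linear_sub bounded_linear_mixed_op[OF f g] bounded_linear_ident)
  have 1: "(1 - q) * norm x \<le> norm (?T x)" for x
    using Tq[of x] norm_triangle_ineq2[of x "?T x"] by (simp add: algebra_simps norm_minus_commute)
  have 2: "(1 - q) * norm x \<le> norm (?T' x)" for x
  proof -
    have "ip x x = ip x (?T' x) - ip (?T x - x) x"
      by (simp add: mixed_op_adjoint[OF f g] ip_diff_left)
    then have "norm (ip x x) \<le> norm (ip x (?T' x)) + norm (ip (?T x - x) x)"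
      by (metis norm_triangle_ineq4)
    also have "\<dots> \<le> norm x * norm (?T' x) + q * norm x * norm x"
      using ip_cauchy_schwarz[of x "?T' x"] ip_cauchy_schwarz[of "?T x - x" x]
        mult_right_mono[OF Tq[of x], of "norm x"] by simp
    finally have "norm x * ((1 - q) * norm x) \<le> norm x * norm (?T' x)"
      by (simp add: norm_ip_self power2_eq_square algebra_simps)
    then show ?thesis by (cases "x = 0") auto
  qed
  show "surj ?T" "surj ?T'"
    using surj_mixed_ops[OF f g _ 1 2] q by auto
qed

section \<open>Comparison of excesses\<close>

text \<open>
  Modulo the range of \<open>U\<close>, the vectors \<open>d j\<close> are unit vectors; since no nonzero \<open>U x\<close> is
  supported in \<open>J\<close>, those with \<open>j \<in> J\<close> are independent. They lie in the kernel of \<open>V\<^sup>*\<close>, so dual coordinates \<open>N\<close> for them can be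
  deleted from \<open>g\<close>.
\<close>

lemma excess_le_if_surj_mixed_op:
  assumes f: "bessel_bound f A" and g: "bessel_bound g B" and onto: "surj (mixed_op f g)"
  shows "excess smul f \<le> excess smul g"
proof -
  have "\<exists>N. finite N \<and> card N = card J \<and> complete_set smul (g ` (- N))"
    if J: "finite J" and compl: "complete_set smul (f ` (- J))" for J
  proof -
    define z where "z j = inv (mixed_op f g) (g j)" for j
    have z: "mixed_op f g (z j) = g j" for j
      using onto by (simp add: z_def surj_f_inv_f)
    define d where "d j n = (if n = j then 1 else 0) - ip (z j) (f n)" for j n
    have indep: "d j \<notin> coord.span (d ` (J - {j}))" if j: "j \<in> J" for j
    proof
      \<comment> \<open>The sequences that are supported in \<open>J - {j}\<close> modulo the range of \<open>U\<close>.\<close>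
      let ?W = "{c. \<exists>u x. c = (\<lambda>n. u n - ip x (f n)) \<and> (\<forall>n. n \<notin> J - {j} \<longrightarrow> u n = 0)}"
      have "coord.subspace ?W"
      proof (rule coord.subspaceI)
        show "0 \<in> ?W"
          by (auto simp: fun_eq_iff intro!: exI[of _ "\<lambda>_. 0"] exI[of _ "0::'h"])
      next
        fix c c' assume "c \<in> ?W" "c' \<in> ?W"
        then obtain u x u' x' where
          "c = (\<lambda>n. u n - ip x (f n))" "\<forall>n. n \<notin> J - {j} \<longrightarrow> u n = 0"
          "c' = (\<lambda>n. u' n - ip x' (f n))" "\<forall>n. n \<notin> J - {j} \<longrightarrow> u' n = 0" by blast
        then show "c + c' \<in> ?W"
          by (intro CollectI exI[of _ "\<lambda>n. u n + u' n"] exI[of _ "x + x'"])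
            (auto simp: fun_eq_iff inner_add_left)
      next
        fix a c assume "c \<in> ?W"
        then obtain u x where
          "c = (\<lambda>n. u n - ip x (f n))" "\<forall>n. n \<notin> J - {j} \<longrightarrow> u n = 0" by blast
        then show "(\<lambda>n. a * c n) \<in> ?W"
          by (intro CollectI exI[of _ "\<lambda>n. a * u n"] exI[of _ "smul a x"])
            (auto simp: inner_scale_left right_diff_distrib)
      qed
      moreover have "d i \<in> ?W" if "i \<in> J - {j}" for i
        using that
        by (intro CollectI exI[of _ "\<lambda>n. if n = i then 1 else 0"] exI[of _ "z i"])
          (auto simp: d_def fun_eq_iff)
      ultimately have "coord.span (d ` (J - {j})) \<subseteq> ?W"
        by (intro coord.span_minimal) auto
      moreover assume "d j \<in> coord.span (d ` (J - {j}))"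
      ultimately have "d j \<in> ?W" by (rule subsetD)
      then obtain u x where "d j = (\<lambda>n. u n - ip x (f n))" "\<forall>n. n \<notin> J - {j} \<longrightarrow> u n = 0"
        unfolding mem_Collect_eq by (elim exE conjE)
      then have u: "\<And>n. d j n = u n - ip x (f n)" "\<And>n. n \<notin> J - {j} \<Longrightarrow> u n = 0"
        by simp_all
      have eq: "ip (z j - x) (f n) = (if n = j then 1 else 0) - u n" for n
        using u(1)[of n] by (simp add: d_def ip_diff_left algebra_simps)
      \<comment> \<open>Thus \<open>U (z j - x)\<close> is supported in \<open>J\<close>, with value \<open>1\<close> at \<open>j\<close>.\<close>
      have "z j - x = 0"
        by (rule complete_set_orthogonal_eq_0[OF compl]) (use u(2) j in \<open>auto simp: eq\<close>)
      then have "(1::'k) = 0" using eq[of j] u(2)[of j] by simp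
      then show False by simp
    qed
    obtain N where N: "finite N" "card N = card J"
      and dual: "\<And>i. i \<in> N \<Longrightarrow>
        \<exists>c\<in>coord.span (d ` J). \<forall>n\<in>N. c n = (if n = i then 1 else 0)"
      using exists_dual_coordinates[OF J, of d] indep by blast
    \<comment> \<open>The linear relations between the \<open>g n\<close>.\<close>
    let ?K = "{c. (\<lambda>n. smul (c n) (g n)) sums 0}"
    have "coord.subspace ?K"
    proof (rule coord.subspaceI)
      show "0 \<in> ?K" by simp
    next
      fix c c' assume "c \<in> ?K" "c' \<in> ?K"
      then show "c + c' \<in> ?K"
        using sums_add[of "\<lambda>n. smul (c n) (g n)" 0 "\<lambda>n. smul (c' n) (g n)" 0]
        by (simp add: scale_left_distrib)
    next
      fix a c assume "c \<in> ?K"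
      then show "(\<lambda>n. a * c n) \<in> ?K"
        using bounded_linear.sums[OF bounded_linear_smul_right[of a], of "\<lambda>n. smul (c n) (g n)" 0]
        by simp
    qed
    moreover have "d j \<in> ?K" for j
    proof -
      have "(\<lambda>n. if n = j then g n else 0) sums g j" by (rule sums_single)
      from sums_diff[OF this mixed_op_sums[OF f g, of "z j"]]
      have "(\<lambda>n. (if n = j then g n else 0) - smul (ip (z j) (f n)) (g n)) sums 0"
        by (simp add: z)
      moreover have "(if n = j then g n else 0) - smul (ip (z j) (f n)) (g n) = smul (d j n) (g n)" for n
        by (simp add: d_def scale_left_diff_distrib)
      ultimately show ?thesis by simp
    qed
    ultimately have kernel: "coord.span (d ` J) \<subseteq> ?K"
      by (intro coord.span_minimal) auto
    let ?S = "span (g ` (- N))"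
    have subsp: "subspace (closure ?S)" by (intro subspace_closure subspace_span)
    have removed: "g i \<in> closure ?S" for i
    proof (cases "i \<in> N")
      case False
      then show ?thesis using span_base[of "g i" "g ` (- N)"] closure_subset by blast
    next
      case True
      then obtain c where "c \<in> coord.span (d ` J)" and c: "\<And>n. n \<in> N \<Longrightarrow> c n = (if n = i then 1 else 0)"
        using dual by blast
      then have "(\<lambda>n. smul (c n) (g n)) sums 0" using kernel by blast
      \<comment> \<open>Solved for \<open>g i\<close>, this relation does not involve the other \<open>g n\<close> with \<open>n \<in> N\<close>.\<close>
      from sums_diff[OF sums_single[of i g] this]
      have "(\<lambda>n. (if n = i then g n else 0) - smul (c n) (g n)) sums g i" by simp
      moreover have "(\<Sum>n<k. (if n = i then g n else 0) - smul (c n) (g n)) \<in> ?S" for k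
      proof (intro span_sum)
        fix n
        show "(if n = i then g n else 0) - smul (c n) (g n) \<in> ?S"
          using c[of n] True by (cases "n \<in> N") (auto intro: span_zero span_scale span_neg span_base)
      qed
      ultimately show ?thesis
        unfolding closure_sequential sums_def
        by (intro exI[of _ "\<lambda>k. \<Sum>n<k. (if n = i then g n else 0) - smul (c n) (g n)"]) simp
    qed
    \<comment> \<open>Every vector is a series in the \<open>g n\<close>, as \<open>V\<^sup>*U\<close> is onto.\<close>
    have "x \<in> closure ?S" for x
    proof -
      obtain y where y: "x = mixed_op f g y" using onto by blast
      have "(\<Sum>n<k. smul (ip y (f n)) (g n)) \<in> closure ?S" for k
        by (intro subspace_sum[OF subsp] subspace_scale[OF subsp] removed)
      then show ?thesis
        using closed_sequentially[OF closed_closure _ mixed_op_sums[OF f g, of y, unfolded sums_def]]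
        unfolding y by blast
    qed
    then have "complete_set smul (g ` (- N))"
      unfolding complete_set_def by blast
    then show ?thesis using N by blast
  qed
  then show ?thesis
    unfolding excess_def by (intro Sup_subset_mono) blast
qed

end

theorem corollary2p7:
  fixes smul :: "'k::real_or_complex \<Rightarrow> 'h::banach \<Rightarrow> 'h"
    and ip :: "'h \<Rightarrow> 'h \<Rightarrow> 'k"
    and f g :: "nat \<Rightarrow> 'h"
  assumes "hilbert_space smul ip"
    and "separable_space (euclidean :: 'h topology)"
    and "infinite_dimensional smul"
    and "frame ip f"
    and "frame ip g"
  shows "(pseudo_dual smul ip f g \<longrightarrow> excess smul f = excess smul g) \<and>
         (approximately_dual ip f g \<longrightarrow> excess smul f = excess smul g)"
proof -
  interpret hilbert_space smul ip by fact
  obtain A where f: "bessel_bound f A" using frame_bessel_bound[OF assms(4)] .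
  obtain B where g: "bessel_bound g B" using frame_bessel_bound[OF assms(5)] .
  have "excess smul f = excess smul g"
    if "surj (mixed_op f g)" "surj (mixed_op g f)"
    using excess_le_if_surj_mixed_op[OF f g that(1)] excess_le_if_surj_mixed_op[OF g f that(2)]
    by (rule antisym)
  then show ?thesis
    using pseudo_dual_surj[OF f g] approximately_dual_surj[OF f g] by blast
qed

end
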